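(* For every non-negative integer $\ell$, every finite undirected graph $G$ (loops and multiple edges allowed): (1) either contains no walk of length $\ell$, or contains an avoidable walk of length $\ell$; (2) either contains no path of length $\ell$, or contains an avoidable path of length $\ell$; (3) either contains no induced path of length $\ell$, or contains an avoidable induced path of length $\ell$.
   Context: Graphs are finite and undirected and may have loops and multiple edges. A walk of length $\ell\ge 0$ in $G$ is a sequence $(v_0,e_1,v_1,\ldots,e_\ell,v_\ell)$ of vertices $v_i$ and edges $e_i$ of $G$ such that $e_i$ has endpoints $v_{i-1}$ and $v_i$ for all $i\in\{1,\ldots,\ell\}$; it is closed if $v_0=v_\ell$. A path is a walk in which all vertices are distinct. A subgraph $H$ of $G$ is an induced subgraph of $G$ if the set of edges of $H$ is exactly the set of edges of $G$ having both endpoints in $V(H)$. A path in $G$ can be viewed as a subgraph of $G$; it is an induced path if the corresponding subgraph is induced in $G$. Likewise, an induced cycle is a cycle of $G$ whose corresponding subgraph is induced in $G$. For $t\in\{\text{walk},\text{path},\text{induced path}\}$, a $t$-walk is a walk of type $t$. Extension: if $W=(v_1,e_1,v_2,\ldots,e_{k-1},v_k)$ is a $t$-walk in $G$, a $t$-extension of $W$ is a $t$-walk in $G$ of the form $(v_0,e_0,v_1,e_1,\ldots,e_{k-1},v_k,e_k,v_{k+1})$ for some vertices $v_0,v_{k+1}$ and edges $e_0,e_k$ of $G$. Closable: a $t$-walk is $t$-closable if it is a subwalk of a closed $t$-walk in $G$, where a closed $t$-walk means a closed walk if $t$ is walk, a cycle if $t$ is path, and an induced cycle if $t$ is induced path.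 Avoidable: a $t$-walk $W$ is $t$-avoidable in $G$ if every $t$-extension of $W$ is $t$-closable (in particular, a $t$-walk with no $t$-extension is $t$-avoidable). In (1), (2), (3), "avoidable" means $t$-avoidable for $t=$ walk, path, induced path, respectively.
   Formalization: In (3), "induced" ignores multiplicity: an edge parallel to an edge of H need not lie in H (same as the literal notion when there are no parallel edges). Literally (3) fails: in K_{3,3} with a perfect matching doubled, no vertex is an avoidable induced path of length 0. *)

theory Defs
  imports Main
begin

text \<open>Finite undirected multigraphs: the edges are objects of their own, and ends assigns to an edge
  its set of endpoints. An edge with one endpoint is a loop; edges with equal endpoint sets are
  parallel.\<close>

record ('v, 'e) multigraph =
  verts :: "'v set"
  edges :: "'e set"
  ends :: "'e \<Rightarrow> 'v set"

definition finite_multigraph :: "('v, 'e) multigraph \<Rightarrow> bool" where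
  "finite_multigraph G \<longleftrightarrow> finite (verts G) \<and> finite (edges G) \<and>
     (\<forall>e\<in>edges G. \<exists>u\<in>verts G. \<exists>v\<in>verts G. ends G e = {u, v})"

definition subgraph :: "('v, 'e) multigraph \<Rightarrow> ('v, 'e) multigraph \<Rightarrow> bool" where
  "subgraph H G \<longleftrightarrow> verts H \<subseteq> verts G \<and> edges H \<subseteq> edges G \<and>
     (\<forall>e\<in>edges H. ends H e = ends G e \<and> ends G e \<subseteq> verts H)"

text \<open>Inducedness does not see multiplicities: the two edge sets are compared as sets of endpoint
  sets, so that an edge of \<open>G\<close> parallel to an edge of \<open>H\<close> need not belong to \<open>H\<close>, whereas any other
  edge of \<open>G\<close> within \<open>verts H\<close> (in particular a loop) must. If \<open>G\<close> has no parallel edges, this says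
  that \<open>H\<close> contains exactly the edges of \<open>G\<close> with both endpoints in \<open>verts H\<close>
  (lemma \<open>induced_subgraph_no_parallel\<close>). With that condition in the presence of parallel edges,
  avoidable induced paths need not exist: in \<open>K\<^sub>3\<^sub>,\<^sub>3\<close> with the edges of a perfect matching
  doubled, no vertex would be an avoidable induced path of length 0.\<close>

definition induced_subgraph :: "('v, 'e) multigraph \<Rightarrow> ('v, 'e) multigraph \<Rightarrow> bool" where
  "induced_subgraph H G \<longleftrightarrow> subgraph H G \<and>
     ends G ` edges H = ends G ` {e \<in> edges G. ends G e \<subseteq> verts H}"

lemma induced_subgraph_no_parallel:
  assumes "inj_on (ends G) (edges G)"
  shows "induced_subgraph H G \<longleftrightarrow> subgraph H G \<and> edges H = {e \<in> edges G. ends G e \<subseteq> verts H}"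
proof (cases "subgraph H G")
  case True
  then have "edges H \<subseteq> edges G" by (simp add: subgraph_def)
  moreover have "{e \<in> edges G. ends G e \<subseteq> verts H} \<subseteq> edges G" by blast
  ultimately show ?thesis
    using True inj_on_image_eq_iff[OF assms] by (simp add: induced_subgraph_def)
qed (simp add: induced_subgraph_def)

text \<open>The walk \<open>(v\<^sub>0, e\<^sub>1, v\<^sub>1, \<dots>, e\<^sub>l, v\<^sub>l)\<close> is the pair of lists
  \<open>([v\<^sub>0, \<dots>, v\<^sub>l], [e\<^sub>1, \<dots>, e\<^sub>l])\<close>.\<close>

type_synonym ('v, 'e) vewalk = "'v list \<times> 'e list"

definition walk_length :: "('v, 'e) vewalk \<Rightarrow> nat" where
  "walk_length W = length (snd W)"

definition is_walk :: "('v, 'e) multigraph \<Rightarrow> ('v, 'e) vewalk \<Rightarrow> bool" where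
  "is_walk G W \<longleftrightarrow> (case W of (vs, es) \<Rightarrow>
     length vs = Suc (length es) \<and> set vs \<subseteq> verts G \<and> set es \<subseteq> edges G \<and>
     (\<forall>i<length es. ends G (es ! i) = {vs ! i, vs ! Suc i}))"

definition is_closed_walk :: "('v, 'e) multigraph \<Rightarrow> ('v, 'e) vewalk \<Rightarrow> bool" where
  "is_closed_walk G W \<longleftrightarrow> is_walk G W \<and> hd (fst W) = last (fst W)"

definition is_path :: "('v, 'e) multigraph \<Rightarrow> ('v, 'e) vewalk \<Rightarrow> bool" where
  "is_path G W \<longleftrightarrow> is_walk G W \<and> distinct (fst W)"

text \<open>Loops are cycles of length 1 and pairs of parallel edges form cycles of length 2; the
  distinctness of the edges matters only for length 2.\<close>

definition is_cycle :: "('v, 'e) multigraph \<Rightarrow> ('v, 'e) vewalk \<Rightarrow> bool" where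
  "is_cycle G W \<longleftrightarrow> is_closed_walk G W \<and> 1 \<le> walk_length W \<and>
     distinct (tl (fst W)) \<and> distinct (snd W)"

definition walk_graph :: "('v, 'e) multigraph \<Rightarrow> ('v, 'e) vewalk \<Rightarrow> ('v, 'e) multigraph" where
  "walk_graph G W = \<lparr>verts = set (fst W), edges = set (snd W), ends = ends G\<rparr>"

definition is_induced_path :: "('v, 'e) multigraph \<Rightarrow> ('v, 'e) vewalk \<Rightarrow> bool" where
  "is_induced_path G W \<longleftrightarrow> is_path G W \<and> induced_subgraph (walk_graph G W) G"

definition is_induced_cycle :: "('v, 'e) multigraph \<Rightarrow> ('v, 'e) vewalk \<Rightarrow> bool" where
  "is_induced_cycle G W \<longleftrightarrow> is_cycle G W \<and> induced_subgraph (walk_graph G W) G"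

datatype walk_type = Walk | Path | Induced_Path

fun t_walk :: "walk_type \<Rightarrow> ('v, 'e) multigraph \<Rightarrow> ('v, 'e) vewalk \<Rightarrow> bool" where
  "t_walk Walk G W = is_walk G W"
| "t_walk Path G W = is_path G W"
| "t_walk Induced_Path G W = is_induced_path G W"

fun closed_t_walk :: "walk_type \<Rightarrow> ('v, 'e) multigraph \<Rightarrow> ('v, 'e) vewalk \<Rightarrow> bool" where
  "closed_t_walk Walk G W = is_closed_walk G W"
| "closed_t_walk Path G W = is_cycle G W"
| "closed_t_walk Induced_Path G W = is_induced_cycle G W"

text \<open>A contiguous part of a walk. Cycles come with a starting point; as every rotation of a cycle
  is again a cycle, parts running through the starting point need no separate treatment.\<close>

definition subwalk :: "('v, 'e) vewalk \<Rightarrow> ('v, 'e) vewalk \<Rightarrow> bool" where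
  "subwalk W C \<longleftrightarrow> (\<exists>vs1 vs2 es1 es2. fst C = vs1 @ fst W @ vs2 \<and> snd C = es1 @ snd W @ es2 \<and>
     length vs1 = length es1 \<and> length vs2 = length es2)"

definition t_extension ::
    "walk_type \<Rightarrow> ('v, 'e) multigraph \<Rightarrow> ('v, 'e) vewalk \<Rightarrow> ('v, 'e) vewalk \<Rightarrow> bool" where
  "t_extension t G W W' \<longleftrightarrow> t_walk t G W' \<and>
     (\<exists>u v e f. W' = (u # fst W @ [v], e # snd W @ [f]))"

definition t_closable :: "walk_type \<Rightarrow> ('v, 'e) multigraph \<Rightarrow> ('v, 'e) vewalk \<Rightarrow> bool" where
  "t_closable t G W \<longleftrightarrow> (\<exists>C. closed_t_walk t G C \<and> subwalk W C)"

definition t_avoidable :: "walk_type \<Rightarrow> ('v, 'e) multigraph \<Rightarrow> ('v, 'e) vewalk \<Rightarrow> bool" where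
  "t_avoidable t G W \<longleftrightarrow> (\<forall>W'. t_extension t G W W' \<longrightarrow> t_closable t G W')"

end

theory Submission
  imports Defs
begin

text \<open>Every walk is closable, since it can be traversed backwards (\<open>walk_closable\<close>), so the statement
  about walks is immediate. Paths and induced paths are treated by one argument. For a set \<open>U\<close> of
  vertices let the zone of \<open>U\<close> be \<open>U\<close> itself in the case of paths, and the closed neighbourhood
  \<open>N[U]\<close> in the case of induced paths; say that a path is far from \<open>U\<close> if it misses the zone of \<open>U\<close>.

  Choose a maximal nonempty connected set \<open>U\<close> such that some path on \<open>k\<close> vertices is far from \<open>U\<close>,
  delete the zone of \<open>U\<close>, and take by induction a path \<open>p\<close> on \<open>k\<close> vertices that is avoidable in
  the rest. Consider an extension \<open>x p y\<close>. If \<open>x\<close> and \<open>y\<close> both lie outside the zone, the choice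
  of \<open>p\<close> applies. If both lie in the zone, then they can be joined through \<open>U\<close>, far from \<open>p\<close>, and
  a shortest such connection closes \<open>x p y\<close> to a cycle, which is induced in the induced case. If
  only \<open>x\<close> lies in the zone, then shift: replace \<open>p\<close> by the path \<open>p'\<close> obtained from \<open>p y\<close> by
  dropping its first vertex. The path \<open>p'\<close> also has \<open>k\<close> vertices, and it is far from a larger
  connected set: from \<open>U\<close> together with the first vertex of \<open>p\<close> in the case of paths, and from
  \<open>U\<close> together with \<open>x\<close> in the case of induced paths. This contradicts maximality. If there is
  no such set \<open>U\<close> at all, then no path on \<open>k\<close> vertices has an extension \<open>x p y\<close>, since the
  shifted path would be far from \<open>{x}\<close>.

  The locale \<open>path_system\<close> collects what this argument uses, \<open>ex_avoidable\<close> carries it out, and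
  \<open>path_system_paths\<close> and \<open>path_system_induced_paths\<close> show that it applies. The closing cycles come
  from \<open>geodesic\<close> and \<open>cycle_from_paths\<close>.\<close>

section \<open>Maximal connected sets far from a path\<close>

text \<open>Paths are lists of vertices, and \<open>closes\<close> refers to cycles in one fixed ambient graph, so
  that the induction in \<open>ex_avoidable\<close> can delete vertices without changing its meaning. The list
  \<open>tl p @ [y]\<close> in the axioms is \<open>p\<close> shifted by one step along its extension \<open>x # p @ [y]\<close>. The
  axiom \<open>start\<close> is the step from the empty set to \<open>{x}\<close>, and \<open>grow\<close> is the enlargement that
  contradicts maximality; its new vertex lies on \<open>x # p\<close>, and therefore stays within any set
  containing \<open>x\<close> and \<open>p\<close>.\<close>

locale path_system =
  fixes pth closes :: "'a list \<Rightarrow> bool"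
    and conn :: "'a set \<Rightarrow> bool"
    and zone :: "'a set \<Rightarrow> 'a set"
  assumes pth_rev: "pth p \<Longrightarrow> pth (rev p)"
    and pth_tl: "pth (x # p) \<Longrightarrow> p \<noteq> [] \<Longrightarrow> pth p"
    and subset_zone: "U \<subseteq> zone U"
    and start: "pth (x # p @ [y]) \<Longrightarrow> p \<noteq> [] \<Longrightarrow>
      conn {x} \<and> set (tl p @ [y]) \<inter> zone {x} = {}"
    and grow: "conn U \<Longrightarrow> x \<in> zone U \<Longrightarrow> set (p @ [y]) \<inter> zone U = {} \<Longrightarrow>
      pth (x # p @ [y]) \<Longrightarrow> p \<noteq> [] \<Longrightarrow>
      \<exists>z\<in>insert x (set p) - U. conn (insert z U) \<and> set (tl p @ [y]) \<inter> zone (insert z U) = {}"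
    and close: "conn U \<Longrightarrow> x \<in> zone U \<Longrightarrow> y \<in> zone U \<Longrightarrow> set p \<inter> zone U = {} \<Longrightarrow>
      pth (x # p @ [y]) \<Longrightarrow> p \<noteq> [] \<Longrightarrow> closes (x # p @ [y])"
begin

lemma pth_shift:
  assumes "pth (x # p @ [y])" and "p \<noteq> []"
  shows "pth (tl p @ [y])"
proof -
  have "pth (hd p # tl p @ [y])"
    using pth_tl[OF assms(1)] assms(2) by (cases p) auto
  then show ?thesis using pth_tl by blast
qed

text \<open>Avoidability is relative to the vertex set \<open>S\<close>: only extensions by vertices of \<open>S\<close> count, but
  the closing cycles may leave \<open>S\<close>. This makes the induction work, because a path that is
  avoidable relative to \<open>S - zone U\<close> keeps its closing cycles when \<open>S\<close> is restored. Positivity of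
  \<open>k\<close> is what allows a path to be shifted.\<close>

theorem ex_avoidable:
  assumes "finite S" and "pth p" and "set p \<subseteq> S" and "length p = k" and "0 < k"
  shows "\<exists>p. pth p \<and> set p \<subseteq> S \<and> length p = k \<and>
    (\<forall>x\<in>S. \<forall>y\<in>S. pth (x # p @ [y]) \<longrightarrow> closes (x # p @ [y]))"
  using assms(1-4)
proof (induction "card S" arbitrary: S p rule: less_induct)
  case less
  define far where "far U \<longleftrightarrow> U \<noteq> {} \<and> U \<subseteq> S \<and> conn U \<and>
    (\<exists>q. pth q \<and> set q \<subseteq> S - zone U \<and> length q = k)" for U
  show ?case
  proof (cases "\<exists>U. far U")
    case False
    \<comment> \<open>Every extension would be shifted to a path far from the single vertex \<open>x\<close>.\<close>
    have "\<not> pth (x # p @ [y])" if "x \<in> S" "y \<in> S" for x y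
    proof
      assume ext: "pth (x # p @ [y])"
      have "p \<noteq> []" using less.prems \<open>0 < k\<close> by auto
      moreover have "set (tl p @ [y]) \<subseteq> S"
        using less.prems(3) that \<open>p \<noteq> []\<close> by (auto dest: list.set_sel(2))
      ultimately have "far {x}"
        unfolding far_def using start[OF ext] pth_shift[OF ext] that less.prems(4) \<open>0 < k\<close>
        by (intro conjI exI[of _ "tl p @ [y]"]) auto
      with False show False by blast
    qed
    then show ?thesis using less.prems by blast
  next
    case True
    have "finite {U. far U}"
      by (rule finite_subset[of _ "Pow S"]) (auto simp: far_def less.prems(1))
    then obtain U where "far U" and max: "\<And>U'. far U' \<Longrightarrow> U \<subseteq> U' \<Longrightarrow> U' = U"
      using finite_has_maximal[of "{U. far U}"] True by auto
    then have U: "U \<noteq> {}" "U \<subseteq> S" "conn U" by (auto simp: far_def)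
    obtain q where q: "pth q" "set q \<subseteq> S - zone U" "length q = k"
      using \<open>far U\<close> by (auto simp: far_def)
    have "S - zone U \<subset> S" using U subset_zone[of U] by blast
    then have "card (S - zone U) < card S"
      by (simp add: less.prems(1) psubset_card_mono)
    from less.hyps[OF this _ q] less.prems(1)
    obtain r where r: "pth r" "set r \<subseteq> S - zone U" "length r = k"
      and avoidable: "\<And>x y. x \<in> S - zone U \<Longrightarrow> y \<in> S - zone U \<Longrightarrow> pth (x # r @ [y]) \<Longrightarrow>
        closes (x # r @ [y])"
      by auto
    \<comment> \<open>Stated for any \<open>s\<close> with the vertices of \<open>r\<close>, so that it covers both \<open>r\<close> and \<open>rev r\<close>: an
      extension with only its last vertex in the zone is read backwards.\<close>
    have mixed: False if "x \<in> S" "y \<in> S" "x \<in> zone U" "y \<notin> zone U" "pth (x # s @ [y])"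
      "set s = set r" "length s = k" for x y s
    proof -
      have "s \<noteq> []" using that \<open>0 < k\<close> by auto
      have "set (s @ [y]) \<inter> zone U = {}" using that r by auto
      from grow[OF U(3) that(3) this that(5) \<open>s \<noteq> []\<close>]
      obtain z where z: "z \<in> insert x (set s) - U" "conn (insert z U)"
        "set (tl s @ [y]) \<inter> zone (insert z U) = {}" by blast
      have "set (tl s @ [y]) \<subseteq> S"
        using r(2) that \<open>s \<noteq> []\<close> by (auto dest: list.set_sel(2))
      then have "far (insert z U)"
        unfolding far_def using z U r(2) that \<open>0 < k\<close> pth_shift[OF that(5) \<open>s \<noteq> []\<close>]
        by (intro conjI exI[of _ "tl s @ [y]"]) auto
      with max[of "insert z U"] z(1) show False by blast
    qed
    have "closes (x # r @ [y])" if "x \<in> S" "y \<in> S" and ext: "pth (x # r @ [y])" for x y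
    proof -
      have "r \<noteq> []" using r \<open>0 < k\<close> by auto
      have "pth (y # rev r @ [x])" using pth_rev[OF ext] by simp
      then have "x \<in> zone U \<longleftrightarrow> y \<in> zone U"
        using mixed[of x y r] mixed[of y x "rev r"] that r by auto
      moreover have "set r \<inter> zone U = {}" using r(2) by blast
      ultimately show ?thesis
        using close[OF U(3) _ _ _ ext \<open>r \<noteq> []\<close>] avoidable[OF _ _ ext] that by blast
    qed
    then show ?thesis using r by blast
  qed
qed

end

section \<open>Walks as vertex lists\<close>

text \<open>Requiring \<open>u \<noteq> v\<close> discards loops, so that adjacency is that of the underlying simple graph.\<close>

definition adj :: "('v, 'e) multigraph \<Rightarrow> 'v \<Rightarrow> 'v \<Rightarrow> bool" where
  "adj G u v \<longleftrightarrow> u \<noteq> v \<and> (\<exists>e\<in>edges G. ends G e = {u, v})"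

lemma adj_sym: "adj G u v \<Longrightarrow> adj G v u"
  by (auto simp: adj_def insert_commute)

text \<open>The endpoint sets of the edges traversed by a walk depend only on its list of vertices. Hence
  inducedness, which compares sets of endpoint sets, is a property of that list (\<open>chordless\<close>).\<close>

fun steps :: "'v list \<Rightarrow> 'v set set" where
  "steps (x # y # zs) = insert {x, y} (steps (y # zs))"
| "steps _ = {}"

lemma steps_subset: "s \<in> steps vs \<Longrightarrow> s \<subseteq> set vs"
  by (induction vs rule: steps.induct) auto

lemma steps_append: "steps (xs @ y # zs) = steps (xs @ [y]) \<union> steps (y # zs)"
  by (induction xs rule: steps.induct) auto

lemma steps_rev: "steps (rev vs) = steps vs"
proof (induction vs rule: steps.induct)
  case (1 x y zs)
  then show ?case using steps_append[of "rev zs" y "[x]"] by (auto simp: insert_commute)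
qed auto

lemma is_walk_simps:
  "is_walk G ([x], []) \<longleftrightarrow> x \<in> verts G"
  "is_walk G (x # y # vs, e # es) \<longleftrightarrow>
     x \<in> verts G \<and> e \<in> edges G \<and> ends G e = {x, y} \<and> is_walk G (y # vs, es)"
  by (auto simp: is_walk_def nth_Cons less_Suc_eq_0_disj split: nat.splits)

lemma is_walk_induct [consumes 1, case_names single step]:
  assumes "is_walk G (vs, es)"
    and "\<And>x. x \<in> verts G \<Longrightarrow> P [x] []"
    and "\<And>x y vs e es. x \<in> verts G \<Longrightarrow> e \<in> edges G \<Longrightarrow> ends G e = {x, y} \<Longrightarrow>
      is_walk G (y # vs, es) \<Longrightarrow> P (y # vs) es \<Longrightarrow> P (x # y # vs) (e # es)"
  shows "P vs es"
  using assms(1)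
proof (induction es arbitrary: vs)
  case Nil
  then obtain x where "vs = [x]" by (auto simp: is_walk_def length_Suc_conv)
  with Nil assms(2) show ?case by (simp add: is_walk_simps)
next
  case (Cons e es)
  then obtain x y ws where "vs = x # y # ws" by (auto simp: is_walk_def length_Suc_conv)
  with Cons assms(3) show ?case by (simp add: is_walk_simps)
qed

lemma is_walk_append:
  assumes "is_walk G (xs @ [y], es)" and "is_walk G (y # zs, fs)"
  shows "is_walk G (xs @ y # zs, es @ fs)"
proof -
  have "is_walk G (vs, es) \<Longrightarrow> last vs = y \<Longrightarrow> is_walk G (vs @ zs, es @ fs)" for vs
    by (induction rule: is_walk_induct) (auto simp: is_walk_simps assms(2))
  from this[OF assms(1)] show ?thesis by simp
qed

lemma is_walk_rev: "is_walk G (vs, es) \<Longrightarrow> is_walk G (rev vs, rev es)"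
proof (induction rule: is_walk_induct)
  case (step x y vs e es)
  have "y \<in> verts G" using step.hyps by (auto simp: is_walk_def)
  with step have "is_walk G ([y, x], [e])" by (auto simp: is_walk_simps)
  with step.IH show ?case using is_walk_append[of G "rev vs" y "rev es" "[x]" "[e]"] by simp
qed (simp add: is_walk_simps)

lemma ends_image_walk: "is_walk G (vs, es) \<Longrightarrow> ends G ` set es = steps vs"
  by (induction rule: is_walk_induct) auto

lemma walk_imp_successively:
  "is_walk G (vs, es) \<Longrightarrow> distinct vs \<Longrightarrow> successively (adj G) vs"
  by (induction rule: is_walk_induct) (auto simp: adj_def)

lemma successively_imp_walk:
  assumes "successively (adj G) vs" and "vs \<noteq> []" and "set vs \<subseteq> verts G"
  shows "\<exists>es. is_walk G (vs, es)"
  using assms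
proof (induction vs rule: induct_list012)
  case (2 x)
  then have "is_walk G ([x], [])" by (simp add: is_walk_simps)
  then show ?case ..
next
  case (3 x y zs)
  then obtain es where "is_walk G (y # zs, es)" by auto
  moreover obtain e where "e \<in> edges G" "ends G e = {x, y}"
    using 3 by (auto simp: adj_def)
  ultimately have "is_walk G (x # y # zs, e # es)" using 3 by (simp add: is_walk_simps)
  then show ?case ..
qed simp

text \<open>The first edge of a walk with distinct vertices contains the first vertex, which no later edge
  contains.\<close>

lemma path_edges_distinct: "is_walk G (vs, es) \<Longrightarrow> distinct vs \<Longrightarrow> distinct es"
proof (induction rule: is_walk_induct)
  case (step x y vs e es)
  have "e \<notin> set es"
  proof
    assume "e \<in> set es"
    then have "{x, y} \<in> steps (y # vs)" using ends_image_walk[OF step(4)] step(3) by force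
    with steps_subset step.prems show False by fastforce
  qed
  with step show ?case by simp
qed simp

definition path_verts :: "('v, 'e) multigraph \<Rightarrow> 'v list \<Rightarrow> bool" where
  "path_verts G vs \<longleftrightarrow>
     vs \<noteq> [] \<and> set vs \<subseteq> verts G \<and> distinct vs \<and> successively (adj G) vs"

text \<open>Loops and, for closed walks, the step back to the start are included on purpose, so that
  \<open>chordless\<close> expresses inducedness for paths and for cycles alike (\<open>induced_walk_graph_iff\<close>).\<close>

definition chordless :: "('v, 'e) multigraph \<Rightarrow> 'v list \<Rightarrow> bool" where
  "chordless G vs \<longleftrightarrow> (\<forall>e\<in>edges G. ends G e \<subseteq> set vs \<longrightarrow> ends G e \<in> steps vs)"

lemma path_verts_iff: "path_verts G vs \<longleftrightarrow> (\<exists>es. is_path G (vs, es))"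
proof
  assume "path_verts G vs"
  then show "\<exists>es. is_path G (vs, es)"
    using successively_imp_walk by (auto simp: path_verts_def is_path_def)
next
  assume "\<exists>es. is_path G (vs, es)"
  then obtain es where walk: "is_walk G (vs, es)" and "distinct vs"
    by (auto simp: is_path_def)
  then show "path_verts G vs"
    using walk_imp_successively[OF walk] by (auto simp: path_verts_def is_walk_def)
qed

lemma induced_walk_graph_iff:
  assumes "is_walk G (vs, es)"
  shows "induced_subgraph (walk_graph G (vs, es)) G \<longleftrightarrow> chordless G vs"
proof -
  have sub: "ends G e \<subseteq> set vs" if "e \<in> set es" for e
    using ends_image_walk[OF assms] steps_subset that by blast
  then have "subgraph (walk_graph G (vs, es)) G"
    using assms by (auto simp: subgraph_def walk_graph_def is_walk_def)
  moreover have "ends G ` set es \<subseteq> ends G ` {e \<in> edges G. ends G e \<subseteq> set vs}"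
    using sub assms by (auto simp: is_walk_def)
  ultimately show ?thesis
    unfolding induced_subgraph_def chordless_def ends_image_walk[OF assms, symmetric]
    by (auto simp: walk_graph_def)
qed

lemma induced_path_verts_iff:
  "path_verts G vs \<and> chordless G vs \<longleftrightarrow> (\<exists>es. is_induced_path G (vs, es))"
  unfolding path_verts_iff is_induced_path_def
  using induced_walk_graph_iff by (auto simp: is_path_def)

lemma path_verts_rev: "path_verts G vs \<Longrightarrow> path_verts G (rev vs)"
  by (auto simp: path_verts_def intro: successively_mono adj_sym)

lemma path_verts_tl: "path_verts G (x # p) \<Longrightarrow> p \<noteq> [] \<Longrightarrow> path_verts G p"
  by (auto simp: path_verts_def successively_Cons)

lemma chordless_rev: "chordless G (rev vs) \<longleftrightarrow> chordless G vs"
  by (simp add: chordless_def steps_rev)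

lemma chordless_tl:
  assumes "chordless G (x # p)" and "x \<notin> set p"
  shows "chordless G p"
  using assms by (cases p) (auto simp: chordless_def)

lemma induced_path_adj_start:
  assumes "chordless G (x # y # p)" and "distinct (x # y # p)" and "z \<in> set (x # y # p)"
    and "adj G x z"
  shows "z = y"
proof -
  from assms(4) obtain e where "e \<in> edges G" "ends G e = {x, z}" "x \<noteq> z"
    by (auto simp: adj_def)
  then have "{x, z} \<in> steps (x # y # p)" using assms by (force simp: chordless_def)
  then show ?thesis using \<open>x \<noteq> z\<close> steps_subset assms(2) by (fastforce simp: doubleton_eq_iff)
qed

section \<open>Connected sets and geodesics\<close>

definition joins :: "('v, 'e) multigraph \<Rightarrow> 'v set \<Rightarrow> 'v \<Rightarrow> 'v \<Rightarrow> 'v list \<Rightarrow> bool" where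
  "joins G A x y r \<longleftrightarrow>
     r \<noteq> [] \<and> hd r = x \<and> last r = y \<and> set r \<subseteq> A \<and> successively (adj G) r"

definition connected_in :: "('v, 'e) multigraph \<Rightarrow> 'v set \<Rightarrow> bool" where
  "connected_in G U \<longleftrightarrow> (\<forall>a\<in>U. \<forall>b\<in>U. \<exists>r. joins G U a b r)"

lemma joins_single: "x \<in> A \<Longrightarrow> joins G A x x [x]"
  by (simp add: joins_def)

lemma joins_Cons: "joins G A u y r \<Longrightarrow> adj G x u \<Longrightarrow> joins G (insert x A) x y (x # r)"
  by (auto simp: joins_def successively_Cons)

lemma joins_snoc: "joins G A x u r \<Longrightarrow> adj G u y \<Longrightarrow> joins G (insert y A) x y (r @ [y])"
  by (auto simp: joins_def successively_append_iff)

lemma joins_mono: "joins G A x y r \<Longrightarrow> A \<subseteq> B \<Longrightarrow> joins G B x y r"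
  by (auto simp: joins_def)

lemma connected_in_single: "connected_in G {x}"
  using joins_single[of x "{x}"] by (auto simp: connected_in_def)

lemma connected_in_insert:
  assumes "connected_in G U" and "u \<in> U" and "adj G u x"
  shows "connected_in G (insert x U)"
  unfolding connected_in_def
proof (intro ballI)
  fix a b assume ab: "a \<in> insert x U" "b \<in> insert x U"
  have U: "\<exists>r. joins G U c d r" if "c \<in> U" "d \<in> U" for c d
    using assms(1) that by (simp add: connected_in_def)
  have "\<exists>r. joins G (insert x U) c x r" if "c \<in> U" for c
    using U[OF that assms(2)] joins_snoc assms(3) by metis
  moreover have "\<exists>r. joins G (insert x U) x c r" if "c \<in> U" for c
    using U[OF assms(2) that] joins_Cons adj_sym[OF assms(3)] by metis
  moreover have "\<exists>r. joins G (insert x U) x x r"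
    using joins_single[of x "insert x U" G] by auto
  moreover have "\<exists>r. joins G (insert x U) c d r" if "c \<in> U" "d \<in> U" for c d
    using U[OF that] joins_mono[OF _ subset_insertI] by (elim exE) (intro exI)
  ultimately show "\<exists>r. joins G (insert x U) a b r"
    using ab by (cases "a = x"; cases "b = x") simp_all
qed

text \<open>A shortest connection repeats no vertex and has no chord, since either would give a shortcut.
  Chords are taken with respect to \<open>adj\<close> and thus are not loops.\<close>

lemma geodesic:
  assumes "joins G A x y r0"
  obtains r where "joins G A x y r" and "distinct r"
    and "\<And>u v. u \<in> set r \<Longrightarrow> v \<in> set r \<Longrightarrow> adj G u v \<Longrightarrow> {u, v} \<in> steps r"
proof -
  obtain r where r: "joins G A x y r" and min: "\<And>r'. joins G A x y r' \<Longrightarrow> length r \<le> length r'"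
    using assms ex_has_least_nat[of "joins G A x y" r0 length] by blast
  have "distinct r"
  proof (rule ccontr)
    assume "\<not> distinct r"
    then obtain as b bs cs where eq: "r = as @ [b] @ bs @ [b] @ cs"
      using not_distinct_decomp by blast
    then have "joins G A x y (as @ [b] @ cs)"
      using r by (auto simp: joins_def successively_append_iff successively_Cons hd_append
          split: if_splits)
    from min[OF this] eq show False by simp
  qed
  moreover have shortcut: "bs = []"
    if eq: "r = as @ u # bs @ v # cs" and "adj G u v" for as u bs v cs
  proof -
    have "joins G A x y (as @ u # v # cs)"
      using r that by (auto simp: joins_def successively_append_iff successively_Cons hd_append
          split: if_splits)
    from min[OF this] eq show ?thesis by simp
  qed
  have "{u, v} \<in> steps r" if uv: "u \<in> set r" "v \<in> set r" "adj G u v" for u v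
  proof -
    have "u \<noteq> v" using uv by (simp add: adj_def)
    obtain as rest where 1: "r = as @ u # rest" using split_list[OF uv(1)] by blast
    with uv(2) \<open>u \<noteq> v\<close> consider "v \<in> set as" | "v \<in> set rest" by auto
    then show ?thesis
    proof cases
      case 1
      then obtain bs cs where "as = bs @ v # cs" using split_list by metis
      with \<open>r = as @ u # rest\<close> have eq: "r = bs @ v # cs @ u # rest" by simp
      from shortcut[OF eq adj_sym[OF uv(3)]] eq show ?thesis
        using steps_append[of bs v "u # rest"] by (auto simp: insert_commute)
    next
      case 2
      then obtain bs cs where "rest = bs @ v # cs" using split_list by metis
      with 1 have eq: "r = as @ u # bs @ v # cs" by simp
      from shortcut[OF eq uv(3)] eq show ?thesis
        using steps_append[of as u "v # cs"] by auto
    qed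
  qed
  ultimately show thesis using that r by blast
qed

lemma joins_distinct_decomp:
  assumes "joins G A x y r" and "distinct r" and "x \<noteq> y"
  obtains q where "r = x # q @ [y]"
proof -
  obtain r' where r': "r = x # r'" using assms by (cases r) (auto simp: joins_def)
  with assms have "r' \<noteq> []" "last r' = y" by (auto simp: joins_def)
  then have "r = x # butlast r' @ [y]" using r' by (metis append_butlast_last_id)
  then show thesis using that by blast
qed

text \<open>Two paths between \<open>x\<close> and \<open>y\<close> with disjoint interiors form a cycle. The edges \<open>es\<close> of the
  first path are prescribed, because an extension that has to be closed comes with a choice among
  parallel edges; those of the second path are arbitrary. Since \<open>p\<close> is nonempty, the first path
  does not use an edge between \<open>x\<close> and \<open>y\<close>, which is the only kind of edge that the two paths
  could share.\<close>

lemma cycle_from_paths: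
  assumes path: "is_path G (x # p @ [y], es)" and "p \<noteq> []"
    and ret: "path_verts G (x # q @ [y])" and disj: "set p \<inter> set q = {}"
  obtains fs where "is_cycle G (x # p @ [y] @ rev q @ [x], es @ fs)"
    and "subwalk (x # p @ [y], es) (x # p @ [y] @ rev q @ [x], es @ fs)"
proof -
  have "path_verts G (y # rev q @ [x])" using path_verts_rev[OF ret] by simp
  then obtain fs where fs: "is_walk G (y # rev q @ [x], fs)"
    by (auto simp: path_verts_iff is_path_def)
  have es: "is_walk G (x # p @ [y], es)" and dist: "distinct (x # p @ [y])"
    using path by (auto simp: is_path_def)
  have dist_back: "distinct (x # q @ [y])" using ret by (simp add: path_verts_def)
  have walk: "is_walk G (x # p @ [y] @ rev q @ [x], es @ fs)"
    using is_walk_append[of G "x # p" y es "rev q @ [x]" fs] es fs by simp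
  have "set es \<inter> set fs = {}"
  proof (rule ccontr)
    assume "set es \<inter> set fs \<noteq> {}"
    then obtain e where e: "e \<in> set es" "e \<in> set fs" by blast
    have 1: "ends G e \<in> steps (x # p @ [y])" using e ends_image_walk[OF es] by blast
    have 2: "ends G e \<in> steps (y # rev q @ [x])" using e ends_image_walk[OF fs] by blast
    have "ends G e \<subseteq> {x, y}"
      using steps_subset[OF 1] steps_subset[OF 2] disj dist dist_back by auto
    moreover obtain z p' where p: "p = z # p'" using \<open>p \<noteq> []\<close> by (cases p) auto
    have "steps (x # p @ [y]) = insert {x, z} (steps (p @ [y]))" using p by simp
    moreover have "x \<in> ends G e \<and> y \<in> ends G e"
    proof -
      have "e \<in> edges G" using e es by (auto simp: is_walk_def)
      have "\<exists>a b. a \<noteq> b \<and> s = {a, b}" if "s \<in> steps vs" "distinct vs" for s and vs :: "'a list"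
        using that by (induction vs rule: steps.induct) auto
      from this[OF 1 dist] \<open>ends G e \<subseteq> {x, y}\<close> show ?thesis by auto
    qed
    ultimately have "ends G e = {x, z} \<or> ends G e \<in> steps (p @ [y])" using 1 by auto
    then show False
      using \<open>x \<in> ends G e \<and> y \<in> ends G e\<close> steps_subset[of "ends G e" "p @ [y]"] dist p by auto
  qed
  moreover have "distinct es" using path_edges_distinct[OF es dist] .
  moreover have "distinct fs" using path_edges_distinct[OF fs] dist_back by auto
  moreover have "distinct (p @ [y] @ rev q @ [x])" using dist dist_back disj by auto
  moreover have "es \<noteq> []" using es by (auto simp: is_walk_def)
  ultimately have "is_cycle G (x # p @ [y] @ rev q @ [x], es @ fs)"
    using walk by (auto simp: is_cycle_def is_closed_walk_def walk_length_def Suc_le_eq)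
  moreover have "subwalk (x # p @ [y], es) (x # p @ [y] @ rev q @ [x], es @ fs)"
  proof -
    have "length (rev q @ [x]) = length fs" using fs by (simp add: is_walk_def)
    then show ?thesis unfolding subwalk_def
      by (intro exI[of _ "[]"] exI[of _ "rev q @ [x]"] exI[of _ fs]) simp
  qed
  ultimately show thesis using that by blast
qed

section \<open>Paths and induced paths as path systems\<close>

text \<open>Closability must hold for every choice of edges along the list, since extensions with the same
  vertices may use different parallel edges.\<close>

definition always_closable :: "walk_type \<Rightarrow> ('v, 'e) multigraph \<Rightarrow> 'v list \<Rightarrow> bool" where
  "always_closable t G vs \<longleftrightarrow> (\<forall>es. t_walk t G (vs, es) \<longrightarrow> t_closable t G (vs, es))"

text \<open>A connected \<open>U\<close> is its own zone. If \<open>x \<in> U\<close> and \<open>x # p @ [y]\<close> is a path that otherwise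
  misses \<open>U\<close>, then \<open>hd p\<close> can be added to \<open>U\<close>, and the shifted path avoids it.\<close>

lemma path_system_paths:
  fixes G :: "('v, 'e) multigraph"
  shows "path_system (path_verts G) (always_closable Path G)
    (\<lambda>U. U \<subseteq> verts G \<and> connected_in G U) (\<lambda>U. U)"
proof
  fix p :: "'v list" and x y :: 'v and U :: "'v set"
  show "path_verts G (rev p)" if "path_verts G p" using that by (rule path_verts_rev)
  show "path_verts G p" if "path_verts G (x # p)" "p \<noteq> []" using that by (rule path_verts_tl)
  show "({x} \<subseteq> verts G \<and> connected_in G {x}) \<and> set (tl p @ [y]) \<inter> {x} = {}"
    if "path_verts G (x # p @ [y])" "p \<noteq> []"
    using that connected_in_single[of G x] by (auto simp: path_verts_def dest: list.set_sel(2))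
  show "\<exists>z\<in>insert x (set p) - U. (insert z U \<subseteq> verts G \<and> connected_in G (insert z U)) \<and>
      set (tl p @ [y]) \<inter> insert z U = {}"
    if U: "U \<subseteq> verts G \<and> connected_in G U" and x: "x \<in> U" and disj: "set (p @ [y]) \<inter> U = {}"
      and path: "path_verts G (x # p @ [y])" and "p \<noteq> []"
  proof -
    obtain z q where p: "p = z # q" using \<open>p \<noteq> []\<close> by (cases p) auto
    then have "connected_in G (insert z U)"
      using connected_in_insert[of G U x z] U x path by (auto simp: path_verts_def)
    then show ?thesis using p U disj path by (intro bexI[of _ z]) (auto simp: path_verts_def)
  qed
  show "always_closable Path G (x # p @ [y])"
    if U: "U \<subseteq> verts G \<and> connected_in G U" and xy: "x \<in> U" "y \<in> U" and disj: "set p \<inter> U = {}"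
      and path: "path_verts G (x # p @ [y])" and "p \<noteq> []"
  proof -
    obtain r0 where "joins G U x y r0" using U xy unfolding connected_in_def by blast
    then obtain r where r: "joins G U x y r" "distinct r" using geodesic by metis
    moreover have "x \<noteq> y" using path by (auto simp: path_verts_def)
    ultimately obtain q where q: "r = x # q @ [y]" using joins_distinct_decomp by metis
    have ret: "path_verts G (x # q @ [y])" using r U q by (auto simp: path_verts_def joins_def)
    have "set p \<inter> set q = {}" using disj r q by (auto simp: joins_def)
    then have "t_closable Path G (x # p @ [y], es)" if "is_path G (x # p @ [y], es)" for es
      using cycle_from_paths[OF that \<open>p \<noteq> []\<close> ret] unfolding t_closable_def closed_t_walk.simps
      by blast
    then show ?thesis by (simp add: always_closable_def)
  qed
qed simp

definition nhd :: "('v, 'e) multigraph \<Rightarrow> 'v set \<Rightarrow> 'v set" where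
  "nhd G U = U \<union> {v. \<exists>u\<in>U. adj G u v}"

lemma nhd_insert: "nhd G (insert x U) = nhd G {x} \<union> nhd G U"
  by (auto simp: nhd_def)

text \<open>The zone of \<open>U\<close> is its closed neighbourhood. If \<open>x # p @ [y]\<close> is an induced path for which only
  \<open>x\<close> is in the zone, then \<open>x\<close> is a neighbour of \<open>U\<close> and can be added to it; being adjacent to
  \<open>hd p\<close> only, \<open>x\<close> has no neighbour on the shifted path. The sets \<open>U\<close> consist of vertices without
  loops because closing cycles run through \<open>U\<close> and must be induced; the vertices of induced paths
  have no loops anyway.\<close>

lemma path_system_induced_paths:
  fixes G :: "('v, 'e) multigraph"
  assumes "finite_multigraph G"
  shows "path_system (\<lambda>vs. path_verts G vs \<and> chordless G vs) (always_closable Induced_Path G)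
    (\<lambda>U. U \<subseteq> {v \<in> verts G. \<forall>e\<in>edges G. ends G e \<noteq> {v}} \<and> connected_in G U) (nhd G)"
    (is "path_system ?pth _ ?conn _")
proof
  fix p :: "'v list" and x y :: 'v and U :: "'v set"
  have loopless: "ends G e \<noteq> {v}" if "?pth vs" "v \<in> set vs" "e \<in> edges G" for e v vs
  proof
    assume "ends G e = {v}"
    with that have "{v} \<in> steps vs" by (force simp: chordless_def)
    moreover have "distinct vs" using that by (simp add: path_verts_def)
    ultimately show False by (induction vs rule: steps.induct) auto
  qed
  have far_start: "set (tl p @ [y]) \<inter> nhd G {x} = {}"
    if "?pth (x # p @ [y])" "p \<noteq> []" for x y p
  proof -
    obtain z q where p: "p = z # q" using \<open>p \<noteq> []\<close> by (cases p) auto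
    then show ?thesis using that induced_path_adj_start[of G x z "q @ [y]"]
      by (auto simp: nhd_def path_verts_def)
  qed
  show "?pth (rev p)" if "?pth p" using that by (simp add: path_verts_rev chordless_rev)
  show "?pth p" if "?pth (x # p)" "p \<noteq> []"
    using that path_verts_tl chordless_tl by (auto simp: path_verts_def successively_Cons)
  show "U \<subseteq> nhd G U" by (auto simp: nhd_def)
  show "?conn {x} \<and> set (tl p @ [y]) \<inter> nhd G {x} = {}"
    if "?pth (x # p @ [y])" "p \<noteq> []"
    using far_start[OF that] loopless[OF that(1)] connected_in_single[of G x] that
    by (auto simp: path_verts_def)
  have not_in_U: "x \<notin> U" if "path_verts G (x # p @ [y])" "set p \<inter> nhd G U = {}" "p \<noteq> []" for x p y
    using that by (cases p) (auto simp: path_verts_def nhd_def)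
  show "\<exists>z\<in>insert x (set p) - U. ?conn (insert z U) \<and>
      set (tl p @ [y]) \<inter> nhd G (insert z U) = {}"
    if U: "?conn U" and x: "x \<in> nhd G U" and disj: "set (p @ [y]) \<inter> nhd G U = {}"
      and path: "?pth (x # p @ [y])" and "p \<noteq> []"
  proof -
    have "x \<notin> U" using not_in_U[of x p y] path disj \<open>p \<noteq> []\<close> by auto
    with x obtain u where u: "u \<in> U" "adj G u x" by (auto simp: nhd_def)
    then have "connected_in G (insert x U)" using connected_in_insert U by metis
    moreover have "set (tl p @ [y]) \<inter> nhd G (insert x U) = {}"
      unfolding nhd_insert[of G x U]
      using far_start[OF path \<open>p \<noteq> []\<close>] disj \<open>p \<noteq> []\<close> by (auto dest: list.set_sel(2))
    ultimately show ?thesis using \<open>x \<notin> U\<close> U path loopless[OF path]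
      by (intro bexI[of _ x]) (auto simp: path_verts_def)
  qed
  show "always_closable Induced_Path G (x # p @ [y])"
    if U: "?conn U" and xy: "x \<in> nhd G U" "y \<in> nhd G U" and disj: "set p \<inter> nhd G U = {}"
      and path: "?pth (x # p @ [y])" and "p \<noteq> []"
  proof -
    have "x \<notin> U" using not_in_U[of x p y] path disj \<open>p \<noteq> []\<close> by auto
    moreover have "y \<notin> U"
      using not_in_U[of y "rev p" x] path_verts_rev[of G "x # p @ [y]"] path disj \<open>p \<noteq> []\<close> by auto
    ultimately obtain u v where uv: "u \<in> U" "v \<in> U" "adj G u x" "adj G v y"
      using xy by (auto simp: nhd_def)
    obtain r0 where "joins G U u v r0" using U uv unfolding connected_in_def by blast
    then have "joins G (insert y (insert x U)) x y ((x # r0) @ [y])"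
      using joins_Cons joins_snoc adj_sym uv by metis
    then obtain r where r: "joins G (insert y (insert x U)) x y r" "distinct r"
      and short: "\<And>u v. u \<in> set r \<Longrightarrow> v \<in> set r \<Longrightarrow> adj G u v \<Longrightarrow> {u, v} \<in> steps r"
      using geodesic by metis
    moreover have "x \<noteq> y" using path by (auto simp: path_verts_def)
    ultimately obtain q where q: "r = x # q @ [y]" using joins_distinct_decomp by metis
    have qU: "set q \<subseteq> U" using r q by (auto simp: joins_def)
    have ret: "path_verts G (x # q @ [y])"
      using r U q qU path by (auto simp: path_verts_def joins_def)
    have pq: "set p \<inter> set q = {}" using disj qU by (auto simp: nhd_def)
    \<comment> \<open>An edge between \<open>p\<close> and \<open>q\<close> would put a vertex of \<open>p\<close> into the zone, so each edge within
      the cycle lies within one of its two chordless halves.\<close>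
    let ?C = "x # p @ [y] @ rev q @ [x]"
    have steps_C: "steps ?C = steps (x # p @ [y]) \<union> steps r"
      using steps_append[of "x # p" y "rev q @ [x]"] steps_rev[of r] q by simp
    have "chordless G ?C" unfolding chordless_def
    proof (intro ballI impI)
      fix e assume e: "e \<in> edges G" and sub: "ends G e \<subseteq> set ?C"
      obtain a b where ab: "ends G e = {a, b}"
        using assms e by (auto simp: finite_multigraph_def)
      have "a \<noteq> b"
      proof
        assume "a = b"
        then have "ends G e = {a}" using ab by simp
        then show False using sub loopless[OF path _ e] U qU e by auto
      qed
      then have adj: "adj G a b" "adj G b a" using ab e by (auto simp: adj_def insert_commute)
      have "\<not> (c \<in> set p \<and> d \<in> set q)" if "adj G d c" for c d
        using that disj qU by (auto simp: nhd_def)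
      then have "{a, b} \<subseteq> set (x # p @ [y]) \<or> {a, b} \<subseteq> set r"
        using adj sub ab q by auto
      then show "ends G e \<in> steps ?C"
      proof
        assume "{a, b} \<subseteq> set (x # p @ [y])"
        then show ?thesis using path e ab steps_C by (auto simp: chordless_def)
      next
        assume "{a, b} \<subseteq> set r"
        then show ?thesis using short[OF _ _ adj(1)] ab steps_C by auto
      qed
    qed
    then have "t_closable Induced_Path G (x # p @ [y], es)"
      if "is_induced_path G (x # p @ [y], es)" for es
      using cycle_from_paths[OF _ \<open>p \<noteq> []\<close> ret pq, of es] that induced_walk_graph_iff
      unfolding t_closable_def closed_t_walk.simps is_induced_path_def is_induced_cycle_def
        is_cycle_def is_closed_walk_def
      by metis
    then show ?thesis by (simp add: always_closable_def)
  qed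
qed

section \<open>Avoidable walks, paths and induced paths\<close>

text \<open>A walk of length \<open>l\<close> has \<open>l + 1\<close> vertices, so that \<open>ex_avoidable\<close> also serves the case
  \<open>l = 0\<close>.\<close>

lemma (in path_system) ex_avoidable_t_walk:
  assumes "finite (verts G)"
    and pth: "\<And>vs. pth vs \<longleftrightarrow> (\<exists>es. t_walk t G (vs, es))"
    and closes: "\<And>vs. closes vs \<longleftrightarrow> always_closable t G vs"
    and walk: "\<And>W. t_walk t G W \<Longrightarrow> is_walk G W"
    and W: "t_walk t G W"
  shows "\<exists>W'. t_walk t G W' \<and> walk_length W' = walk_length W \<and> t_avoidable t G W'"
proof -
  have len: "length vs = Suc (length es)" "set vs \<subseteq> verts G" if "t_walk t G (vs, es)" for vs es
    using walk[OF that] by (auto simp: is_walk_def)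
  obtain ws fs where "W = (ws, fs)" by force
  then have "pth ws" "set ws \<subseteq> verts G" "length ws = Suc (walk_length W)"
    using W len by (auto simp: pth walk_length_def)
  from ex_avoidable[OF assms(1) this]
  obtain vs where vs: "pth vs" "length vs = Suc (walk_length W)"
    and avoid: "\<And>x y. x \<in> verts G \<Longrightarrow> y \<in> verts G \<Longrightarrow> pth (x # vs @ [y]) \<Longrightarrow>
      closes (x # vs @ [y])" by auto
  obtain es where es: "t_walk t G (vs, es)" using vs pth by blast
  have "t_avoidable t G (vs, es)"
    unfolding t_avoidable_def t_extension_def
  proof (intro allI impI, elim conjE exE)
    fix W' x y e f
    assume W': "t_walk t G W'" "W' = (x # fst (vs, es) @ [y], e # snd (vs, es) @ [f])"
    then have "t_walk t G (x # vs @ [y], e # es @ [f])" by simp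
    then show "t_closable t G W'"
      using avoid[of x y] len(2) pth closes W'(2) by (force simp: always_closable_def)
  qed
  then show ?thesis using es vs len[OF es] by (auto simp: walk_length_def)
qed

text \<open>Walking back along the same edges closes a walk.\<close>

lemma walk_closable:
  assumes "is_walk G W"
  shows "t_closable Walk G W"
proof -
  obtain vs es where W: "W = (vs, es)" by force
  with assms have "vs \<noteq> []" by (auto simp: is_walk_def)
  then obtain xs y where vs: "vs = xs @ [y]" by (metis append_butlast_last_id)
  have "is_walk G (vs @ rev xs, es @ rev es)"
    using is_walk_append[of G xs y es "rev xs" "rev es"] is_walk_rev[of G vs es] assms W vs by simp
  moreover have "hd (vs @ rev xs) = last (vs @ rev xs)"
    using vs by (cases xs) auto
  moreover have "subwalk W (vs @ rev xs, es @ rev es)"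
    using assms unfolding subwalk_def W vs
    by (intro exI[of _ "[]"] exI[of _ "rev xs"] exI[of _ "rev es"]) (simp add: is_walk_def)
  ultimately show ?thesis
    unfolding t_closable_def closed_t_walk.simps is_closed_walk_def by auto
qed

theorem corollary5:
  fixes G :: "('v, 'e) multigraph" and l :: nat
  assumes "finite_multigraph G"
  shows
    "((\<nexists>W. t_walk Walk G W \<and> walk_length W = l) \<or>
      (\<exists>W. t_walk Walk G W \<and> walk_length W = l \<and> t_avoidable Walk G W)) \<and>
     ((\<nexists>W. t_walk Path G W \<and> walk_length W = l) \<or>
      (\<exists>W. t_walk Path G W \<and> walk_length W = l \<and> t_avoidable Path G W)) \<and>
     ((\<nexists>W. t_walk Induced_Path G W \<and> walk_length W = l) \<or>
      (\<exists>W. t_walk Induced_Path G W \<and> walk_length W = l \<and> t_avoidable Induced_Path G W))"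
proof -
  have fin: "finite (verts G)" using assms by (simp add: finite_multigraph_def)
  have "t_avoidable Walk G W" for W
    by (auto simp: t_avoidable_def t_extension_def intro: walk_closable)
  moreover have "\<exists>W'. t_walk Path G W' \<and> walk_length W' = walk_length W \<and> t_avoidable Path G W'"
    if "t_walk Path G W" for W
    using path_system.ex_avoidable_t_walk[OF path_system_paths[of G] fin _ _ _ that]
    by (simp add: path_verts_iff is_path_def)
  moreover have "\<exists>W'. t_walk Induced_Path G W' \<and> walk_length W' = walk_length W \<and>
      t_avoidable Induced_Path G W'" if "t_walk Induced_Path G W" for W
    using path_system.ex_avoidable_t_walk[OF path_system_induced_paths[OF assms] fin _ _ _ that]
    by (simp add: induced_path_verts_iff is_induced_path_def is_path_def)
  ultimately show ?thesis by blast
qed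

end
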